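(* Let $F$ be a gauge on $\mathbb{R}^2$ whose unit circle $S=\{x:F(x)=1\}$ is smooth and strictly convex. Let $\gamma(s)$, $s$ in an open interval $J$, be an oriented smooth curve in $(\mathbb{R}^2,F)$ parametrized by arc length, $F(\gamma'(s))=1$, with arc-length curvature $k_l$. Let $c\in\mathbb{R}$ and let $I(s)=\gamma(s)+(c-s)\gamma'(s)$ be the involute of $\gamma$ (with constant $c$). (i) If $(c-s)k_l(s)>0$ for all $s\in J$, then the evolute of the involute $I$ is $\gamma$; that is, the evolute $E_I$ of $I$ satisfies $E_I(s)=\gamma(s)$ for all $s\in J$. (ii) If $(c-s)k_l(s)<0$ for all $s\in J$, then the reverse evolute of the reverse involute $I^-$ is $\gamma$; that is, with $I^-(\sigma)=I(-\sigma)$, the evolute $E_{(I^-)}$ of $I^-$ satisfies $E_{(I^-)}(-s)=\gamma(s)$ for all $s\in J$.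
   Context: A gauge on $\mathbb{R}^2$ is a function $F:\mathbb{R}^2\to\mathbb{R}$ with $F(x)\ge 0$, $F(x)=0\Leftrightarrow x=0$; $F(\lambda x)=\lambda F(x)$ for $\lambda>0$; $F(x+y)\le F(x)+F(y)$ (no symmetry assumed). Fix a counter-clockwise (periodic) parametrization $\varphi(t)$ of $S$ by $F$-arc length, $F(\varphi'(t))=1$. Arc-length curvature of $\gamma$: write $\gamma'(s)=\varphi(\hat t(s))$ with $\hat t$ continuous; $k_l(s):=\hat t'(s)$. Circular curvature and evolute of a regular oriented curve $\alpha(p)$ with arbitrary parameter $p$: let $s^*$ be its arc length, $ds^*/dp=F(\alpha'(p))$; write $\frac{d\alpha}{ds^*}=\varphi'(t(p))$ with $t$ continuous; the circular curvature is $k_c:=\frac{dt}{ds^*}$, and, when $k_c\ne 0$, the evolute of $\alpha$ is $E_\alpha(p)=\alpha(p)-\frac{1}{k_c(p)}\varphi(t(p))$. For an oriented curve $\alpha(t)$ the reverse curve is $\alpha^-(t)=\alpha(-t)$. *)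

theory Defs
  imports "HOL-Analysis.Analysis"
begin

definition gauge_function :: "(real^2 \<Rightarrow> real) \<Rightarrow> bool" where
  "gauge_function F \<longleftrightarrow>
     (\<forall>x. 0 \<le> F x) \<and> (\<forall>x. F x = 0 \<longleftrightarrow> x = 0) \<and>
     (\<forall>r x. 0 < r \<longrightarrow> F (r *\<^sub>R x) = r * F x) \<and>
     (\<forall>x y. F (x + y) \<le> F x + F y)"

definition unit_circle :: "(real^2 \<Rightarrow> real) \<Rightarrow> (real^2) set" where
  "unit_circle F = {x. F x = 1}"

(* Infinitely often differentiable; meant for open J, where the derivatives on J
   depend only on the values of f on J. *)
definition smooth_curve_on :: "real set \<Rightarrow> (real \<Rightarrow> real^2) \<Rightarrow> bool" where
  "smooth_curve_on J f \<longleftrightarrow>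
     (\<forall>n. \<forall>t\<in>J. ((\<lambda>g u. vector_derivative g (at u)) ^^ n) f differentiable (at t))"

definition regular_curve_on :: "real set \<Rightarrow> (real \<Rightarrow> real^2) \<Rightarrow> bool" where
  "regular_curve_on J f \<longleftrightarrow>
     smooth_curve_on J f \<and> (\<forall>t\<in>J. vector_derivative f (at t) \<noteq> 0)"

(* Regular, periodic with period L, and injective modulo L. *)
definition simple_closed_parametrization ::
    "(real^2) set \<Rightarrow> real \<Rightarrow> (real \<Rightarrow> real^2) \<Rightarrow> bool" where
  "simple_closed_parametrization S L \<psi> \<longleftrightarrow>
     0 < L \<and> regular_curve_on UNIV \<psi> \<and> range \<psi> = S \<and>
     (\<forall>a b. \<psi> a = \<psi> b \<longleftrightarrow> (\<exists>n::int. a - b = of_int n * L))"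

definition smooth_closed_curve :: "(real^2) set \<Rightarrow> bool" where
  "smooth_closed_curve S \<longleftrightarrow> (\<exists>L \<psi>. simple_closed_parametrization S L \<psi>)"

(* Intended for the boundary of a convex body: it contains no nondegenerate segment. *)
definition strictly_convex_curve :: "(real^2) set \<Rightarrow> bool" where
  "strictly_convex_curve S \<longleftrightarrow>
     (\<forall>x\<in>S. \<forall>y\<in>S. x \<noteq> y \<longrightarrow> \<not> closed_segment x y \<subseteq> S)"

(* The origin lies inside the unit circle, so the curve runs counter-clockwise iff
   (\<phi> t, \<phi>' t) is always a positively oriented basis. *)
definition ccw_arc_length_parametrization ::
    "(real^2 \<Rightarrow> real) \<Rightarrow> (real \<Rightarrow> real^2) \<Rightarrow> bool" where
  "ccw_arc_length_parametrization F \<phi> \<longleftrightarrow>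
     (\<exists>L. simple_closed_parametrization (unit_circle F) L \<phi>) \<and>
     (\<forall>t. F (vector_derivative \<phi> (at t)) = 1) \<and>
     (\<forall>t. 0 < \<phi> t $ 1 * vector_derivative \<phi> (at t) $ 2
             - \<phi> t $ 2 * vector_derivative \<phi> (at t) $ 1)"

(* k is the arc-length curvature on J of a curve \<gamma> parametrized by arc length. *)
definition arc_length_curvature ::
    "(real \<Rightarrow> real^2) \<Rightarrow> real set \<Rightarrow> (real \<Rightarrow> real^2) \<Rightarrow> (real \<Rightarrow> real) \<Rightarrow> bool" where
  "arc_length_curvature \<phi> J \<gamma> k \<longleftrightarrow>
     (\<exists>t. continuous_on J t \<and>
          (\<forall>s\<in>J. vector_derivative \<gamma> (at s) = \<phi> (t s)) \<and>
          (\<forall>s\<in>J. (t has_real_derivative k s) (at s)))"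

definition arc_length_function ::
    "(real^2 \<Rightarrow> real) \<Rightarrow> real set \<Rightarrow> (real \<Rightarrow> real^2) \<Rightarrow> (real \<Rightarrow> real) \<Rightarrow> bool" where
  "arc_length_function F J \<alpha> l \<longleftrightarrow>
     (\<forall>p\<in>J. (l has_real_derivative F (vector_derivative \<alpha> (at p))) (at p))"

(* f has derivative v with respect to the new parameter l, at the point with old parameter p:
   f is reparametrized by the inverse of l on J. *)
definition has_derivative_wrt ::
    "real set \<Rightarrow> (real \<Rightarrow> real) \<Rightarrow> (real \<Rightarrow> 'a::real_normed_vector) \<Rightarrow> 'a \<Rightarrow> real \<Rightarrow> bool" where
  "has_derivative_wrt J l f v p \<longleftrightarrow>
     ((f \<circ> inv_into J l) has_vector_derivative v) (at (l p))"

(* k is the circular curvature of the regular curve \<alpha> on J, witnessed by the continuous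
   function t with d\<alpha>/dl = \<phi>' \<circ> t, where l is an arc length of \<alpha>. *)
definition circular_curvature ::
    "(real^2 \<Rightarrow> real) \<Rightarrow> (real \<Rightarrow> real^2) \<Rightarrow> real set \<Rightarrow> (real \<Rightarrow> real^2) \<Rightarrow>
     (real \<Rightarrow> real) \<Rightarrow> (real \<Rightarrow> real) \<Rightarrow> bool" where
  "circular_curvature F \<phi> J \<alpha> t k \<longleftrightarrow>
     (\<exists>l. arc_length_function F J \<alpha> l \<and> continuous_on J t \<and>
          (\<forall>p\<in>J. has_derivative_wrt J l \<alpha> (vector_derivative \<phi> (at (t p))) p) \<and>
          (\<forall>p\<in>J. has_derivative_wrt J l t (k p) p))"

(* E is only determined on J. The function t is determined up to a period of \<phi>, and l up to
   a constant, so E does not depend on these choices. *)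
definition is_evolute ::
    "(real^2 \<Rightarrow> real) \<Rightarrow> (real \<Rightarrow> real^2) \<Rightarrow> real set \<Rightarrow> (real \<Rightarrow> real^2) \<Rightarrow>
     (real \<Rightarrow> real^2) \<Rightarrow> bool" where
  "is_evolute F \<phi> J \<alpha> E \<longleftrightarrow>
     regular_curve_on J \<alpha> \<and>
     (\<exists>t k. circular_curvature F \<phi> J \<alpha> t k \<and>
            (\<forall>p\<in>J. k p \<noteq> 0 \<and> E p = \<alpha> p - (1 / k p) *\<^sub>R \<phi> (t p)))"

definition involute :: "(real \<Rightarrow> real^2) \<Rightarrow> real \<Rightarrow> real \<Rightarrow> real^2" where
  "involute \<gamma> c s = \<gamma> s + (c - s) *\<^sub>R vector_derivative \<gamma> (at s)"

definition reverse_curve :: "(real \<Rightarrow> real^2) \<Rightarrow> real \<Rightarrow> real^2" where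
  "reverse_curve \<alpha> t = \<alpha> (- t)"

end

(* With gamma' = phi o t and t' = k, the involute I satisfies I' = (c - s) k phi'(t). If
   (c - s) k > 0, this is the speed of I and t is its tangent angle, so the circular curvature is
   k / ((c - s) k) = 1 / (c - s) and the evolute is I - (c - s) phi(t) = gamma. If (c - s) k < 0,
   reversing I makes the factor positive and leaves the curvature formula unchanged. *)
theory Submission
  imports Defs
begin

section \<open>Gauges: supporting functionals and tangents of the unit circle\<close>

lemma gauge_functionD:
  assumes "gauge_function F"
  shows "0 \<le> F x" "F x = 0 \<longleftrightarrow> x = 0" "0 < r \<Longrightarrow> F (r *\<^sub>R x) = r * F x"
    "F (x + y) \<le> F x + F y"
  using assms unfolding gauge_function_def by auto

lemma gauge_scaleR:
  assumes "gauge_function F" "0 \<le> r"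
  shows "F (r *\<^sub>R x) = r * F x"
  using assms gauge_functionD(2)[OF assms(1), of 0] gauge_functionD(3)[OF assms(1), of r x]
  by (cases "r = 0") auto

lemma gauge_convex_combination:
  assumes "gauge_function F" "0 \<le> u" "0 \<le> v"
  shows "F (u *\<^sub>R x + v *\<^sub>R y) \<le> u * F x + v * F y"
  using gauge_functionD(4)[OF assms(1)] gauge_scaleR[OF assms(1)] assms by metis

text \<open>The open unit ball of \<open>F\<close> is convex and misses \<open>x\<close>, so a
  hyperplane with some normal \<open>h\<close> separates the two. Homogeneity spreads the bound on
  the ball to the whole plane, and dividing \<open>h\<close> by \<open>h \<bullet> x\<close>
  normalizes it.\<close>

lemma gauge_supporting_functional:
  assumes F: "gauge_function F" and x: "F x = 1"
  obtains g where "g \<bullet> x = 1" "\<And>y. g \<bullet> y \<le> F y"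
proof -
  have "convex {y. F y < 1}"
  proof (rule convexI)
    fix y z :: "real^2" and u v :: real
    assume *: "y \<in> {y. F y < 1}" "z \<in> {y. F y < 1}" "0 \<le> u" "0 \<le> v" "u + v = 1"
    then have "u * F y + v * F z < 1"
      using convex_bound_lt[of "F y" 1 "F z" u v] by auto
    then show "u *\<^sub>R y + v *\<^sub>R z \<in> {y. F y < 1}"
      using gauge_convex_combination[OF F, of u v y z] * by auto
  qed
  moreover have "0 \<in> {y. F y < 1}"
    using gauge_functionD(2)[OF F, of 0] by simp
  ultimately obtain h b where h: "h \<noteq> 0" "\<And>y. F y < 1 \<Longrightarrow> h \<bullet> y \<le> b" "b \<le> h \<bullet> x"
    using separating_hyperplane_sets[of "{y. F y < 1}" "{x}"] x by fastforce
  \<comment> \<open>Separation controls only points of gauge below 1, so \<open>y\<close> is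
    rescaled to gauge \<open>r < 1\<close>. The factor \<open>r\<close> disappears in
    \<open>le\<close>, where \<open>r\<close> ranges over the whole interval from 0 to 1.\<close>
  have bound: "r * (h \<bullet> y) \<le> F y * (h \<bullet> x)" if "y \<noteq> 0" "0 < r" "r < 1" for r y
  proof -
    have Fy: "F y > 0"
      using gauge_functionD(1,2)[OF F, of y] that by linarith
    have "F ((r / F y) *\<^sub>R y) < 1"
      using gauge_scaleR[OF F, of "r / F y" y] Fy that by simp
    then have "(r / F y) * (h \<bullet> y) \<le> h \<bullet> x"
      using h(2)[of "(r / F y) *\<^sub>R y"] h(3) by simp
    then show ?thesis
      using Fy by (simp add: field_simps)
  qed
  have Fh: "F h > 0"
    using gauge_functionD(1,2)[OF F, of h] h(1) by linarith
  \<comment> \<open>Weak separation alone gives only \<open>h \<bullet> x \<ge> 0\<close>. Testing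
    \<open>bound\<close> at \<open>y = h\<close> makes it strict; any \<open>r\<close> between 0 and
    1 would do.\<close>
  have "0 < (1/2) * (h \<bullet> h)"
    using h(1) by simp
  also have "\<dots> \<le> F h * (h \<bullet> x)"
    using bound[of h "1/2"] h(1) by simp
  finally have pos: "h \<bullet> x > 0"
    using Fh zero_less_mult_pos by blast
  have le: "h \<bullet> y \<le> F y * (h \<bullet> x)" for y
  proof (cases "y = 0")
    case True
    then show ?thesis
      using gauge_functionD(1)[OF F, of y] pos by simp
  next
    case False
    show ?thesis
      by (rule field_le_mult_one_interval) (use bound[OF False] in auto)
  qed
  show ?thesis
  proof
    show "(h /\<^sub>R (h \<bullet> x)) \<bullet> x = 1"
      using pos by simp
    show "(h /\<^sub>R (h \<bullet> x)) \<bullet> y \<le> F y" for y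
      using le[of y] pos by (simp add: field_simps)
  qed
qed

text \<open>A supporting functional at \<open>\<phi> a\<close> annihilates \<open>\<phi>' a\<close>, so it is determined by \<open>\<phi> a\<close> and
  \<open>\<phi>' a\<close>. By the orientation, equal tangents give positively proportional functionals, hence equal
  ones, and the segment between the two points of contact lies on the unit circle.\<close>

lemma gauge_circle_tangent_determines_point:
  assumes F: "gauge_function F"
    and convex: "strictly_convex_curve (unit_circle F)"
    and circle: "\<And>t. F (\<phi> t) = 1"
    and deriv: "\<And>t. (\<phi> has_vector_derivative \<phi>' t) (at t)"
    and ccw: "\<And>t. 0 < \<phi> t $ 1 * \<phi>' t $ 2 - \<phi> t $ 2 * \<phi>' t $ 1"
    and eq: "\<phi>' a = \<phi>' b"
  shows "\<phi> a = \<phi> b"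
proof (rule ccontr)
  assume neq: "\<phi> a \<noteq> \<phi> b"
  \<comment> \<open>Cramer's rule for the equations \<open>g \<bullet> \<phi> t = 1\<close> and
    \<open>g \<bullet> \<phi>' t = 0\<close>, cleared of the denominator, which is the orientation
    determinant. The second equation holds because \<open>g \<bullet> \<phi> u\<close> is maximal at
    \<open>u = t\<close>.\<close>
  have formula: "(g \<bullet> y) * (\<phi> t $ 1 * \<phi>' t $ 2 - \<phi> t $ 2 * \<phi>' t $ 1)
      = y $ 1 * \<phi>' t $ 2 - y $ 2 * \<phi>' t $ 1"
    if g: "g \<bullet> \<phi> t = 1" "\<And>y. g \<bullet> y \<le> F y" for g t y
  proof -
    have "((\<lambda>u. g \<bullet> \<phi> u) has_real_derivative g \<bullet> \<phi>' t) (at t)"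
      using bounded_linear.has_vector_derivative[OF bounded_linear_inner_right deriv]
      by (simp add: has_real_derivative_iff_has_vector_derivative)
    moreover have "g \<bullet> \<phi> u \<le> g \<bullet> \<phi> t" for u
      using g(1) g(2)[of "\<phi> u"] circle by simp
    ultimately have "g \<bullet> \<phi>' t = 0"
      using DERIV_local_max zero_less_one by blast
    then have "g $ 1 * \<phi>' t $ 1 + g $ 2 * \<phi>' t $ 2 = 0" "g $ 1 * \<phi> t $ 1 + g $ 2 * \<phi> t $ 2 = 1"
      using g(1) by (simp_all add: inner_vec_def sum_2)
    then show ?thesis
      unfolding inner_vec_def sum_2 inner_real_def by algebra
  qed
  obtain g where g: "g \<bullet> \<phi> a = 1" "\<And>y. g \<bullet> y \<le> F y"
    using gauge_supporting_functional[OF F circle] by blast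
  obtain h where h: "h \<bullet> \<phi> b = 1" "\<And>y. h \<bullet> y \<le> F y"
    using gauge_supporting_functional[OF F circle] by blast
  define A where "A = \<phi> a $ 1 * \<phi>' a $ 2 - \<phi> a $ 2 * \<phi>' a $ 1"
  define B where "B = \<phi> b $ 1 * \<phi>' b $ 2 - \<phi> b $ 2 * \<phi>' b $ 1"
  have pos: "A > 0" "B > 0"
    using ccw by (auto simp: A_def B_def)
  \<comment> \<open>Each functional is evaluated at the other point of contact. The values are
    \<open>A / B\<close> and \<open>B / A\<close>; both are at most 1, so \<open>A = B\<close> and
    \<open>g\<close> touches the circle at both points.\<close>
  have "(h \<bullet> \<phi> a) * B = A" "(g \<bullet> \<phi> b) * A = B"
    using formula[OF h, of "\<phi> a"] formula[OF g, of "\<phi> b"] eq by (auto simp: A_def B_def)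
  moreover have "h \<bullet> \<phi> a \<le> 1" "g \<bullet> \<phi> b \<le> 1"
    using h(2)[of "\<phi> a"] g(2)[of "\<phi> b"] circle by auto
  ultimately have "A \<le> B" "B \<le> A"
    using pos mult_right_mono[of "h \<bullet> \<phi> a" 1 B] mult_right_mono[of "g \<bullet> \<phi> b" 1 A] by auto
  then have gb: "g \<bullet> \<phi> b = 1"
    using \<open>(g \<bullet> \<phi> b) * A = B\<close> pos by simp
  have "closed_segment (\<phi> a) (\<phi> b) \<subseteq> unit_circle F"
  proof
    fix z assume "z \<in> closed_segment (\<phi> a) (\<phi> b)"
    then obtain u where u: "0 \<le> u" "u \<le> 1" "z = (1 - u) *\<^sub>R \<phi> a + u *\<^sub>R \<phi> b"
      by (auto simp: closed_segment_def)
    then have "F z \<le> 1"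
      using gauge_convex_combination[OF F, of "1 - u" u "\<phi> a" "\<phi> b"] circle by simp
    moreover have "g \<bullet> z = 1"
      using u g(1) gb by (simp add: inner_add_right)
    ultimately show "z \<in> unit_circle F"
      using g(2)[of z] by (simp add: unit_circle_def)
  qed
  then show False
    using convex neq circle unfolding strictly_convex_curve_def unit_circle_def by blast
qed

section \<open>Smoothness of involutes and reverse curves\<close>

abbreviation iterated_vector_derivative ::
    "nat \<Rightarrow> (real \<Rightarrow> real^2) \<Rightarrow> real \<Rightarrow> real^2" where
  "iterated_vector_derivative n f \<equiv> ((\<lambda>g u. vector_derivative g (at u)) ^^ n) f"

lemma smooth_curve_onD:
  assumes "smooth_curve_on J f" "t \<in> J"
  shows "(iterated_vector_derivative n f has_vector_derivative
           iterated_vector_derivative (Suc n) f t) (at t)"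
  using assms unfolding smooth_curve_on_def by (simp flip: vector_derivative_works)

text \<open>Reduces smoothness to a closed formula \<open>D n\<close> for the n-th derivative. Since
  \<open>J\<close> is open, agreement of \<open>D n\<close> with the iterated derivative on
  \<open>J\<close> passes to the next derivative, whatever the two do outside
  \<open>J\<close>.\<close>

lemma smooth_curve_onI:
  assumes J: "open J"
    and D0: "\<And>t. t \<in> J \<Longrightarrow> D 0 t = f t"
    and D: "\<And>n t. t \<in> J \<Longrightarrow> (D n has_vector_derivative D (Suc n) t) (at t)"
  shows "smooth_curve_on J f"
proof -
  have eq: "\<forall>t\<in>J. D n t = iterated_vector_derivative n f t" for n
  proof (induction n)
    case 0
    then show ?case using D0 by simp
  next
    case (Suc n)
    show ?case
    proof
      fix t assume t: "t \<in> J"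
      have "(iterated_vector_derivative n f has_vector_derivative D (Suc n) t) (at t)"
        using has_vector_derivative_transform_within_open[OF D[OF t] J t] Suc by blast
      then show "D (Suc n) t = iterated_vector_derivative (Suc n) f t"
        by (simp add: vector_derivative_at)
    qed
  qed
  have "(iterated_vector_derivative n f has_vector_derivative D (Suc n) t) (at t)" if "t \<in> J" for n t
    using has_vector_derivative_transform_within_open[OF D[OF that] J that] eq by blast
  then show ?thesis
    unfolding smooth_curve_on_def by (blast intro: differentiableI_vector)
qed

lemma smooth_curve_on_involute:
  assumes J: "open J" and \<gamma>: "smooth_curve_on J \<gamma>"
  shows "smooth_curve_on J (involute \<gamma> c)"
proof (rule smooth_curve_onI[OF J])
  let ?D = "\<lambda>n. iterated_vector_derivative n \<gamma>"
  \<comment> \<open>Leibniz rule for the n-th derivative of the involute: each differentiation of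
    the factor \<open>c - s\<close> contributes one further negative copy of the n-th derivative of
    \<open>\<gamma>\<close>, whence the coefficient \<open>1 - n\<close>.\<close>
  let ?I = "\<lambda>n s. (1 - of_nat n) *\<^sub>R ?D n s + (c - s) *\<^sub>R ?D (Suc n) s"
  show "?I 0 t = involute \<gamma> c t" for t
    by (simp add: involute_def)
  show "(?I n has_vector_derivative ?I (Suc n) t) (at t)" if "t \<in> J" for n t
    using smooth_curve_onD[OF \<gamma> that, of n] smooth_curve_onD[OF \<gamma> that, of "Suc n"]
    by (auto intro!: derivative_eq_intros simp: algebra_simps simp del: funpow.simps)
qed

lemma has_vector_derivative_reflect:
  fixes f :: "real \<Rightarrow> 'a::real_normed_vector"
  assumes "(f has_vector_derivative v) (at (- t))"
  shows "((\<lambda>u. f (- u)) has_vector_derivative - v) (at t)"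
proof -
  have "(uminus has_vector_derivative - 1) (at t)"
    by (rule has_vector_derivative_minus[OF has_vector_derivative_id, unfolded id_def])
  from vector_diff_chain_at[OF this assms] show ?thesis
    by (simp add: o_def)
qed

lemma smooth_curve_on_reverse_curve:
  assumes J: "open J" and \<alpha>: "smooth_curve_on J \<alpha>"
  shows "smooth_curve_on (uminus ` J) (reverse_curve \<alpha>)"
proof (rule smooth_curve_onI)
  let ?D = "\<lambda>n t. (- 1) ^ n *\<^sub>R iterated_vector_derivative n \<alpha> (- t)"
  show "open (uminus ` J)"
    using J by (rule open_negations)
  show "?D 0 t = reverse_curve \<alpha> t" for t
    by (simp add: reverse_curve_def)
  show "(?D n has_vector_derivative ?D (Suc n) t) (at t)" if "t \<in> uminus ` J" for n t
  proof -
    have "- t \<in> J"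
      using that by auto
    from has_vector_derivative_reflect[OF smooth_curve_onD[OF \<alpha> this, of n]] show ?thesis
      by (auto intro!: derivative_eq_intros simp del: funpow.simps)
  qed
qed

section \<open>Derivatives with respect to arc length\<close>

text \<open>Positive speed makes \<open>l\<close> strictly increasing on the interval, so
  \<open>inv_into J l\<close> really inverts it there and has derivative \<open>1 / w p\<close> at
  \<open>l p\<close>. Both directions are then the chain rule, and the reparametrization never has
  to be handled again.\<close>

lemma has_derivative_wrt_iff:
  assumes J: "open J" "is_interval J"
    and l: "\<forall>p\<in>J. (l has_real_derivative w p) (at p)"
    and w: "\<forall>p\<in>J. 0 < w p"
    and p: "p \<in> J"
  shows "has_derivative_wrt J l f v p \<longleftrightarrow> (f has_vector_derivative w p *\<^sub>R v) (at p)"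
proof -
  have cont: "continuous_on J l"
    using l by (meson DERIV_isCont continuous_at_imp_continuous_on)
  have less: "l a < l b" if ab: "a \<in> J" "b \<in> J" "a < b" for a b
  proof -
    have sub: "{a..b} \<subseteq> J"
      using J(2) ab by (intro connected_contains_Icc) (auto simp: is_interval_connected)
    then have "continuous_on {a..b} l"
      using cont continuous_on_subset by blast
    moreover have "x \<in> J" if "a < x" "x < b" for x
      using that sub by (simp add: subset_iff)
    ultimately show ?thesis
      using DERIV_pos_imp_increasing_open[OF ab(3), of l] l w by blast
  qed
  have inj: "inj_on l J"
    using less by (metis inj_onI less_irrefl linorder_neqE_linordered_idom)
  then have inv: "inv_into J l (l q) = q" if "q \<in> J" for q
    using that by simp
  have wp: "w p > 0" and lp: "(l has_vector_derivative w p) (at p)"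
    using w l p by (auto simp: has_real_derivative_iff_has_vector_derivative)
  show ?thesis
  proof
    assume "has_derivative_wrt J l f v p"
    then have "((f \<circ> inv_into J l) \<circ> l has_vector_derivative w p *\<^sub>R v) (at p)"
      unfolding has_derivative_wrt_def by (rule vector_diff_chain_at[OF lp])
    then show "(f has_vector_derivative w p *\<^sub>R v) (at p)"
      by (rule has_vector_derivative_transform_within_open[OF _ J(1) p]) (simp add: inv)
  next
    assume f: "(f has_vector_derivative w p *\<^sub>R v) (at p)"
    have "(inv_into J l has_derivative (\<lambda>x. x *\<^sub>R (1 / w p))) (at (l p))"
      by (rule has_derivative_inverse_strong[OF J(1) p cont inv lp[unfolded has_vector_derivative_def]])
        (use wp in auto)
    then have "(inv_into J l has_vector_derivative 1 / w p) (at (l p))"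
      by (simp add: has_vector_derivative_def)
    from vector_diff_chain_at[OF this, of f "w p *\<^sub>R v"] f wp show "has_derivative_wrt J l f v p"
      unfolding has_derivative_wrt_def by (simp add: inv[OF p])
  qed
qed

section \<open>Uniqueness of the tangent angle and of the evolute\<close>

text \<open>Distinct values are at least \<open>L\<close> apart, and a continuous function with such
  discrete values on a connected set cannot jump. It serves for the difference of two tangent angles
  of one curve.\<close>

lemma continuous_on_multiples_constant:
  fixes f :: "real \<Rightarrow> real"
  assumes "connected J" "continuous_on J f" "0 < L"
    and f: "\<And>x. x \<in> J \<Longrightarrow> \<exists>n::int. f x = of_int n * L"
  shows "f constant_on J"
proof (rule continuous_discrete_range_constant[OF assms(1,2)])
  fix x assume x: "x \<in> J"
  have "L \<le> norm (f y - f x)" if y: "y \<in> J" "f y \<noteq> f x" for y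
  proof -
    obtain m n :: int where mn: "f x = of_int m * L" "f y = of_int n * L"
      using f[OF x] f[OF y(1)] by blast
    with y have "1 \<le> \<bar>n - m\<bar>"
      by force
    then have "1 \<le> \<bar>of_int (n - m) :: real\<bar>"
      by linarith
    then have "1 * L \<le> \<bar>of_int (n - m)\<bar> * L"
      using \<open>0 < L\<close> by (intro mult_right_mono) auto
    then show ?thesis
      using \<open>0 < L\<close> mn by (simp add: abs_mult flip: left_diff_distrib)
  qed
  then show "\<exists>e>0. \<forall>y. y \<in> J \<and> f y \<noteq> f x \<longrightarrow> e \<le> norm (f y - f x)"
    using \<open>0 < L\<close> by blast
qed

text \<open>The tangent angle of \<open>\<alpha>\<close> is unique up to a multiple of the period, which is constant on the
  interval by continuity; hence the circular curvature and the evolute are unique.\<close>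

lemma is_evolute_iff:
  assumes F: "gauge_function F"
    and convex: "strictly_convex_curve (unit_circle F)"
    and \<phi>: "ccw_arc_length_parametrization F \<phi>"
    and J: "open J" "is_interval J"
    and smooth: "smooth_curve_on J \<alpha>"
    and \<alpha>: "\<And>p. p \<in> J \<Longrightarrow>
              (\<alpha> has_vector_derivative w p *\<^sub>R vector_derivative \<phi> (at (\<tau> p))) (at p)"
    and w: "\<forall>p\<in>J. 0 < w p"
    and l: "\<forall>p\<in>J. (l has_real_derivative w p) (at p)"
    and \<tau>: "\<And>p. p \<in> J \<Longrightarrow> (\<tau> has_real_derivative \<kappa> p) (at p)"
    and \<kappa>: "\<And>p. p \<in> J \<Longrightarrow> \<kappa> p \<noteq> 0"
  shows "is_evolute F \<phi> J \<alpha> E \<longleftrightarrow> (\<forall>p\<in>J. E p = \<alpha> p - (w p / \<kappa> p) *\<^sub>R \<phi> (\<tau> p))"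
proof -
  define \<phi>' where "\<phi>' t = vector_derivative \<phi> (at t)" for t
  obtain L where L: "simple_closed_parametrization (unit_circle F) L \<phi>"
    and unit: "\<And>t. F (\<phi>' t) = 1"
    and ccw: "\<And>t. 0 < \<phi> t $ 1 * \<phi>' t $ 2 - \<phi> t $ 2 * \<phi>' t $ 1"
    using \<phi> unfolding ccw_arc_length_parametrization_def \<phi>'_def by blast
  have circle: "F (\<phi> t) = 1" for t
    using L unfolding simple_closed_parametrization_def unit_circle_def by auto
  have "smooth_curve_on UNIV \<phi>"
    using L unfolding simple_closed_parametrization_def regular_curve_on_def by blast
  then have deriv: "(\<phi> has_vector_derivative \<phi>' t) (at t)" for t
    using smooth_curve_onD[of UNIV \<phi> t 0] by (simp add: \<phi>'_def)
  have L0: "L > 0" and period: "\<And>a b. \<phi> a = \<phi> b \<Longrightarrow> \<exists>n::int. a - b = of_int n * L"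
    using L unfolding simple_closed_parametrization_def by blast+
  note tangent = gauge_circle_tangent_determines_point[OF F convex circle deriv ccw]
  have \<alpha>': "vector_derivative \<alpha> (at p) = w p *\<^sub>R \<phi>' (\<tau> p)" if "p \<in> J" for p
    using \<alpha>[OF that] by (simp add: vector_derivative_at \<phi>'_def)
  have speed: "F (vector_derivative \<alpha> (at p)) = w p" if "p \<in> J" for p
    using \<alpha>'[OF that] gauge_scaleR[OF F, of "w p"] w that unit by (simp add: less_imp_le)
  have "\<phi>' t \<noteq> 0" for t
    using unit[of t] gauge_functionD(2)[OF F, of 0] by auto
  then have regular: "regular_curve_on J \<alpha>"
    using smooth \<alpha>' w unfolding regular_curve_on_def by force
  have \<tau>_cont: "continuous_on J \<tau>"
    using \<tau> by (meson DERIV_isCont continuous_at_imp_continuous_on)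
  show ?thesis
  proof
    assume E: "\<forall>p\<in>J. E p = \<alpha> p - (w p / \<kappa> p) *\<^sub>R \<phi> (\<tau> p)"
    \<comment> \<open>Arc length grows at rate \<open>w\<close>, so the rate \<open>\<kappa>\<close>
      of the angle in the parameter \<open>p\<close> becomes \<open>\<kappa> / w\<close> with
      respect to arc length.\<close>
    have "circular_curvature F \<phi> J \<alpha> \<tau> (\<lambda>p. \<kappa> p / w p)"
      unfolding circular_curvature_def
    proof (intro exI[of _ l] conjI ballI)
      show "arc_length_function F J \<alpha> l"
        using l speed by (simp add: arc_length_function_def)
      show "has_derivative_wrt J l \<alpha> (vector_derivative \<phi> (at (\<tau> p))) p" if "p \<in> J" for p
        using \<alpha>[OF that] by (rule has_derivative_wrt_iff[OF J l w that, THEN iffD2])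
      show "has_derivative_wrt J l \<tau> (\<kappa> p / w p) p" if "p \<in> J" for p
        by (rule has_derivative_wrt_iff[OF J l w that, THEN iffD2])
          (use \<tau>[OF that] w that in
            \<open>auto simp: has_real_derivative_iff_has_vector_derivative\<close>)
    qed (rule \<tau>_cont)
    moreover have "\<forall>p\<in>J. \<kappa> p / w p \<noteq> 0 \<and> E p = \<alpha> p - (1 / (\<kappa> p / w p)) *\<^sub>R \<phi> (\<tau> p)"
      using E \<kappa> w by force
    ultimately show "is_evolute F \<phi> J \<alpha> E"
      unfolding is_evolute_def using regular by blast
  next
    assume "is_evolute F \<phi> J \<alpha> E"
    then obtain t k m where arc: "arc_length_function F J \<alpha> m" and t_cont: "continuous_on J t"
      and \<alpha>_wrt: "\<And>p. p \<in> J \<Longrightarrow> has_derivative_wrt J m \<alpha> (\<phi>' (t p)) p"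
      and t_wrt: "\<And>p. p \<in> J \<Longrightarrow> has_derivative_wrt J m t (k p) p"
      and E: "\<And>p. p \<in> J \<Longrightarrow> E p = \<alpha> p - (1 / k p) *\<^sub>R \<phi> (t p)"
      unfolding is_evolute_def circular_curvature_def \<phi>'_def by blast
    \<comment> \<open>The arc length \<open>m\<close> of the given evolute may differ from
      \<open>l\<close>, but its derivative is the speed of \<open>\<alpha>\<close>, which is
      \<open>w\<close> by \<open>speed\<close>.\<close>
    have m: "\<forall>p\<in>J. (m has_real_derivative w p) (at p)"
      using arc speed unfolding arc_length_function_def by fastforce
    note wrtD = has_derivative_wrt_iff[OF J m w, THEN iffD1]
    \<comment> \<open>Both angles represent the same velocity of \<open>\<alpha>\<close>. Cancelling
      the positive speed gives equal tangents of the unit circle, and strict convexity, through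
      \<open>tangent\<close>, gives equal points.\<close>
    have \<phi>_eq: "\<phi> (t p) = \<phi> (\<tau> p)" if p: "p \<in> J" for p
    proof (rule tangent)
      have "w p *\<^sub>R \<phi>' (t p) = w p *\<^sub>R \<phi>' (\<tau> p)"
        using wrtD[OF p \<alpha>_wrt[OF p]] \<alpha>'[OF p] by (simp add: vector_derivative_at)
      then show "\<phi>' (t p) = \<phi>' (\<tau> p)"
        using w p by force
    qed
    have "(\<lambda>p. t p - \<tau> p) constant_on J"
      using J(2) period \<phi>_eq L0
      by (intro continuous_on_multiples_constant[of _ _ L] continuous_intros t_cont \<tau>_cont)
        (auto simp: is_interval_connected)
    then obtain d where d: "\<And>p. p \<in> J \<Longrightarrow> t p = \<tau> p + d"
      unfolding constant_on_def by (metis add.commute diff_add_cancel)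
    \<comment> \<open>The derivative of \<open>t\<close> in the parameter \<open>p\<close> is
      computed twice: as that of \<open>\<tau> + d\<close>, and through the arc length
      \<open>m\<close>.\<close>
    have k: "w p * k p = \<kappa> p" if p: "p \<in> J" for p
    proof -
      have "((\<lambda>p. \<tau> p + d) has_vector_derivative \<kappa> p) (at p)"
        using \<tau>[OF p] by (auto intro!: derivative_eq_intros
            simp: has_real_derivative_iff_has_vector_derivative)
      then have "(t has_vector_derivative \<kappa> p) (at p)"
        by (rule has_vector_derivative_transform_within_open[OF _ J(1) p]) (simp add: d)
      then show ?thesis
        using vector_derivative_unique_at[OF wrtD[OF p t_wrt[OF p]]] by simp
    qed
    show "\<forall>p\<in>J. E p = \<alpha> p - (w p / \<kappa> p) *\<^sub>R \<phi> (\<tau> p)"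
    proof
      fix p assume p: "p \<in> J"
      have "1 / k p = w p / \<kappa> p"
        using k[OF p, symmetric] w p by force
      then show "E p = \<alpha> p - (w p / \<kappa> p) *\<^sub>R \<phi> (\<tau> p)"
        using E[OF p] \<phi>_eq[OF p] by simp
    qed
  qed
qed

section \<open>Arc length of the involute and the two sign cases\<close>

lemma interval_antiderivative:
  fixes f :: "real \<Rightarrow> real"
  assumes J: "open J" "is_interval J" and f: "continuous_on J f"
  obtains G where "\<And>x. x \<in> J \<Longrightarrow> (G has_real_derivative f x) (at x)"
proof (cases "J = {}")
  case True
  then show ?thesis using that by blast
next
  case False
  then obtain c where c: "c \<in> J" by blast
  have "((\<lambda>u. LBINT y=c..u. f y) has_real_derivative f x) (at x)" if x: "x \<in> J" for x
  proof -
    have "min c x \<in> J" "max c x \<in> J"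
      using c x by (auto simp: min_def max_def)
    \<comment> \<open>The segment between \<open>c\<close> and \<open>x\<close> is widened at both
      ends inside \<open>J\<close>. This makes \<open>x\<close> an interior point, so the derivative
      within the closed interval becomes a two-sided one, also when \<open>x = c\<close>.\<close>
    then obtain d e where d: "d > 0" "cball (min c x) d \<subseteq> J" and e: "e > 0" "cball (max c x) e \<subseteq> J"
      using J(1) open_contains_cball by metis
    let ?a = "min c x - d" and ?b = "max c x + e"
    have "?a \<in> cball (min c x) d" "?b \<in> cball (max c x) e"
      using d(1) e(1) by (simp_all add: dist_real_def)
    then have "?a \<in> J" "?b \<in> J"
      using d(2) e(2) by blast+
    then have "{?a..?b} \<subseteq> J"
      using J(2) by (intro connected_contains_Icc) (auto simp: is_interval_connected)
    then have "continuous_on {?a..?b} f"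
      using f continuous_on_subset by blast
    then have "((\<lambda>u. LBINT y=c..u. f y) has_vector_derivative f x) (at x within {?a..?b})"
      using d(1) e(1) by (intro interval_integral_FTC2) auto
    moreover have "x \<in> interior {?a..?b}"
      using d(1) e(1) by (auto simp: interior_atLeastAtMost_real)
    ultimately show ?thesis
      by (metis at_within_interior has_real_derivative_iff_has_vector_derivative)
  qed
  then show ?thesis using that by blast
qed

theorem theorem4p1:
  fixes F :: "real^2 \<Rightarrow> real" and \<phi> \<gamma> :: "real \<Rightarrow> real^2"
    and k\<^sub>l :: "real \<Rightarrow> real" and J :: "real set" and c :: real
  assumes "gauge_function F"
    and "smooth_closed_curve (unit_circle F)"
    and "strictly_convex_curve (unit_circle F)"
    and "ccw_arc_length_parametrization F \<phi>"
    and "open J" and "is_interval J"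
    and "smooth_curve_on J \<gamma>"
    and "\<forall>s\<in>J. F (vector_derivative \<gamma> (at s)) = 1"
    and "arc_length_curvature \<phi> J \<gamma> k\<^sub>l"
  shows "((\<forall>s\<in>J. (c - s) * k\<^sub>l s > 0) \<longrightarrow>
            (\<exists>E. is_evolute F \<phi> J (involute \<gamma> c) E) \<and>
            (\<forall>E. is_evolute F \<phi> J (involute \<gamma> c) E \<longrightarrow> (\<forall>s\<in>J. E s = \<gamma> s))) \<and>
         ((\<forall>s\<in>J. (c - s) * k\<^sub>l s < 0) \<longrightarrow>
            (\<exists>E. is_evolute F \<phi> (uminus ` J) (reverse_curve (involute \<gamma> c)) E) \<and>
            (\<forall>E. is_evolute F \<phi> (uminus ` J) (reverse_curve (involute \<gamma> c)) E \<longrightarrow>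
                 (\<forall>s\<in>J. reverse_curve E s = \<gamma> s)))"
proof -
  let ?I = "involute \<gamma> c" and ?R = "reverse_curve (involute \<gamma> c)"
  let ?\<phi>' = "\<lambda>t. vector_derivative \<phi> (at t)"
  note J = \<open>open J\<close> \<open>is_interval J\<close>
  note evolute_iff = is_evolute_iff[OF assms(1,3,4)]
  obtain t where t_cont: "continuous_on J t"
    and \<gamma>': "\<And>s. s \<in> J \<Longrightarrow> vector_derivative \<gamma> (at s) = \<phi> (t s)"
    and t: "\<And>s. s \<in> J \<Longrightarrow> (t has_real_derivative k\<^sub>l s) (at s)"
    using assms(9) unfolding arc_length_curvature_def by blast
  have "smooth_curve_on UNIV \<phi>"
    using assms(4)
    unfolding ccw_arc_length_parametrization_def simple_closed_parametrization_def
      regular_curve_on_def by blast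
  then have \<phi>: "(\<phi> has_vector_derivative ?\<phi>' u) (at u)" for u
    using smooth_curve_onD[of UNIV \<phi> u 0] by simp
  have I_smooth: "smooth_curve_on J ?I"
    using J(1) assms(7) by (rule smooth_curve_on_involute)
  \<comment> \<open>On \<open>J\<close> the involute is
    \<open>\<gamma> + (c - u) \<phi> (t u)\<close>. The derivative of \<open>\<gamma>\<close>
    cancels against that of the factor \<open>c - u\<close>, and only the derivative of
    \<open>\<phi>\<close> along \<open>t\<close> remains.\<close>
  have I': "(?I has_vector_derivative ((c - s) * k\<^sub>l s) *\<^sub>R ?\<phi>' (t s)) (at s)" if s: "s \<in> J" for s
  proof -
    have "((\<lambda>u. \<phi> (t u)) has_vector_derivative k\<^sub>l s *\<^sub>R ?\<phi>' (t s)) (at s)"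
      using vector_diff_chain_at[OF _ \<phi>] t[OF s]
      by (simp add: o_def has_real_derivative_iff_has_vector_derivative)
    moreover have "(\<gamma> has_vector_derivative \<phi> (t s)) (at s)"
      using smooth_curve_onD[OF assms(7) s, of 0] \<gamma>'[OF s] by simp
    ultimately have "((\<lambda>u. \<gamma> u + (c - u) *\<^sub>R \<phi> (t u)) has_vector_derivative
        ((c - s) * k\<^sub>l s) *\<^sub>R ?\<phi>' (t s)) (at s)"
      by (auto intro!: derivative_eq_intros)
    then show ?thesis
      by (rule has_vector_derivative_transform_within_open[OF _ J(1) s])
        (simp add: involute_def \<gamma>')
  qed
  obtain T where T: "\<And>s. s \<in> J \<Longrightarrow> (T has_real_derivative t s) (at s)"
    using interval_antiderivative[OF J t_cont] by blast
  (* Integration by parts avoids having to know that the curvature is continuous. *)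
  define l where "l s = (c - s) * t s + T s" for s
  have l: "(l has_real_derivative (c - s) * k\<^sub>l s) (at s)" if "s \<in> J" for s
    unfolding l_def using t[OF that] T[OF that] by (auto intro!: derivative_eq_intros)
  have I_eq: "?I s - (c - s) *\<^sub>R \<phi> (t s) = \<gamma> s" if "s \<in> J" for s
    using \<gamma>'[OF that] by (simp add: involute_def)
  show ?thesis
  proof (intro conjI impI)
    assume pos: "\<forall>s\<in>J. (c - s) * k\<^sub>l s > 0"
    then have nz: "k\<^sub>l s \<noteq> 0" if "s \<in> J" for s
      using that by force
    \<comment> \<open>The equivalence yields both claims at once: existence by taking
      \<open>E = \<gamma>\<close>, and uniqueness on \<open>J\<close>.\<close>
    have "is_evolute F \<phi> J ?I E \<longleftrightarrow> (\<forall>s\<in>J. E s = \<gamma> s)" for E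
    proof -
      have "is_evolute F \<phi> J ?I E
          \<longleftrightarrow> (\<forall>s\<in>J. E s = ?I s - ((c - s) * k\<^sub>l s / k\<^sub>l s) *\<^sub>R \<phi> (t s))"
        by (rule evolute_iff[where l = l]) (use pos l t nz J I_smooth I' in auto)
      also have "\<dots> \<longleftrightarrow> (\<forall>s\<in>J. E s = \<gamma> s)"
        using nz I_eq by (intro ball_cong) auto
      finally show ?thesis .
    qed
    then show "\<exists>E. is_evolute F \<phi> J ?I E"
      "\<forall>E. is_evolute F \<phi> J ?I E \<longrightarrow> (\<forall>s\<in>J. E s = \<gamma> s)"
      by blast+
  next
    assume neg: "\<forall>s\<in>J. (c - s) * k\<^sub>l s < 0"
    then have nz: "k\<^sub>l s \<noteq> 0" if "s \<in> J" for s
      using that by force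
    have "is_evolute F \<phi> (uminus ` J) ?R E \<longleftrightarrow> (\<forall>p\<in>uminus ` J. E p = \<gamma> (- p))" for E
    proof -
      \<comment> \<open>The velocity of \<open>?R\<close> at \<open>p\<close> is a positive multiple
        of the tangent \<open>\<phi>'\<close> at \<open>t (- p)\<close>, so this is its tangent
        angle, without any appeal to symmetry of \<open>F\<close>. Speed factor and angle derivative
        both change sign under reversal, so their quotient is again \<open>c - s\<close> with
        \<open>s = - p\<close>.\<close>
      have "is_evolute F \<phi> (uminus ` J) ?R E \<longleftrightarrow> (\<forall>p\<in>uminus ` J. E p =
          ?R p - (- ((c - - p) * k\<^sub>l (- p)) / - k\<^sub>l (- p)) *\<^sub>R \<phi> (t (- p)))"
      proof (rule evolute_iff[where l = "\<lambda>p. l (- p)"])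
        show "open (uminus ` J)" "is_interval (uminus ` J)"
          using J open_negations by auto
        show "smooth_curve_on (uminus ` J) ?R"
          using J(1) I_smooth by (rule smooth_curve_on_reverse_curve)
        show "\<forall>p\<in>uminus ` J. 0 < - ((c - - p) * k\<^sub>l (- p))"
          using neg by simp
        show "\<forall>p\<in>uminus ` J.
            ((\<lambda>p. l (- p)) has_real_derivative - ((c - - p) * k\<^sub>l (- p))) (at p)"
          using has_vector_derivative_reflect[of l] l
          by (auto simp: has_real_derivative_iff_has_vector_derivative)
        fix p assume "p \<in> uminus ` J"
        then have p: "- p \<in> J" by auto
        show "(?R has_vector_derivative (- ((c - - p) * k\<^sub>l (- p))) *\<^sub>R ?\<phi>' (t (- p))) (at p)"
          using has_vector_derivative_reflect[OF I'[OF p]] unfolding reverse_curve_def by simp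
        show "((\<lambda>p. t (- p)) has_real_derivative - k\<^sub>l (- p)) (at p)"
          using has_vector_derivative_reflect[of t] t[OF p]
          by (simp add: has_real_derivative_iff_has_vector_derivative)
        show "- k\<^sub>l (- p) \<noteq> 0"
          using nz[OF p] by simp
      qed
      also have "\<dots> \<longleftrightarrow> (\<forall>p\<in>uminus ` J. E p = \<gamma> (- p))"
        using nz I_eq by (intro ball_cong) (auto simp: reverse_curve_def)
      finally show ?thesis .
    qed
    then have "is_evolute F \<phi> (uminus ` J) ?R E \<longleftrightarrow> (\<forall>s\<in>J. reverse_curve E s = \<gamma> s)" for E
      by (simp add: reverse_curve_def)
    \<comment> \<open>This supplies the witness for existence: \<open>reverse_curve \<gamma>\<close>
      is an evolute of \<open>?R\<close>.\<close>
    moreover have "reverse_curve (reverse_curve \<gamma>) s = \<gamma> s" for s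
      by (simp add: reverse_curve_def)
    ultimately show "\<exists>E. is_evolute F \<phi> (uminus ` J) ?R E"
      "\<forall>E. is_evolute F \<phi> (uminus ` J) ?R E \<longrightarrow> (\<forall>s\<in>J. reverse_curve E s = \<gamma> s)"
      by blast+
  qed
qed

end
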